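(* For all natural numbers $m,n$, the polytope $\operatorname{Hom}(\Box_m,\triangle_n)$ has exactly $(n+1)(mn+1)$ vertices. Moreover, $\operatorname{Hom}(\Box_m,\triangle_n)$ is affinely isomorphic to the convex hull in $\mathbb{R}^{n+nm}$ of the points $$0,\quad 2e_i,\quad e_i+e_{ik},\quad e_i-e_{ik},\quad (e_i+e_j)+(e_{ik}-e_{jk})\ \ (i\ne j),$$ where $i,j$ range over $\{1,\ldots,n\}$ and $k$ over $\{1,\ldots,m\}$, and these points are exactly its vertices.
   Context: For convex polytopes $P,Q$, $\operatorname{Hom}(P,Q)$ is the set of maps $P\to Q$ that are restrictions of affine maps $\operatorname{Aff}(P)\to\operatorname{Aff}(Q)$; it is a convex polytope in the affine space of affine maps $\operatorname{Aff}(P)\to\operatorname{Aff}(Q)$. $\triangle_n=\operatorname{conv}(0,e_1,\ldots,e_n)\subset\mathbb{R}^n$, $\Box_m=\operatorname{conv}\{(a_1,\ldots,a_m):a_i=\pm1\}\subset\mathbb{R}^m$. In $\mathbb{R}^{n+nm}$ the standard basis vectors are indexed by single indices $i\in\{1,\ldots,n\}$ (denoted $e_i$) and double indices $(i,k)$ with $i\in\{1,\ldots,n\}$, $k\in\{1,\ldots,m\}$ (denoted $e_{ik}$). *)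

theory Defs
  imports "HOL-Analysis.Analysis" "HOL-Library.Function_Algebras"
begin

section \<open>Functions into a real vector space form a real vector space (pointwise)\<close>

instantiation "fun" :: (type, real_vector) real_vector
begin
definition scaleR_fun :: "real \<Rightarrow> ('a \<Rightarrow> 'b) \<Rightarrow> 'a \<Rightarrow> 'b"
  where "scaleR_fun c f = (\<lambda>x. c *\<^sub>R f x)"
instance
  by standard (auto simp: scaleR_fun_def fun_eq_iff scaleR_add_right scaleR_add_left)
end

section \<open>Affine maps and Hom(P,Q)\<close>

text \<open>A map is affine on an affine set A if it preserves affine combinations of two points.\<close>
definition affine_map_on :: "'a::real_vector set \<Rightarrow> ('a \<Rightarrow> 'b::real_vector) \<Rightarrow> bool" where
  "affine_map_on A g \<longleftrightarrow>
     (\<forall>x\<in>A. \<forall>y\<in>A. \<forall>u::real. g ((1 - u) *\<^sub>R x + u *\<^sub>R y) = (1 - u) *\<^sub>R g x + u *\<^sub>R g y)"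

text \<open>Hom(P,Q): affine maps Aff(P) \<rightarrow> Aff(Q) mapping P into Q. A map on Aff(P) is encoded
  as a total function that is 0 outside Aff(P), so Hom(P,Q) lives in the real vector
  space of functions.\<close>
definition Hom :: "'a::real_vector set \<Rightarrow> 'b::real_vector set \<Rightarrow> ('a \<Rightarrow> 'b) set" where
  "Hom P Q = {f. affine_map_on (affine hull P) f
                 \<and> f ` (affine hull P) \<subseteq> affine hull Q
                 \<and> f ` P \<subseteq> Q
                 \<and> (\<forall>x. x \<notin> affine hull P \<longrightarrow> f x = 0)}"

definition affinely_isomorphic :: "'a::real_vector set \<Rightarrow> 'b::real_vector set \<Rightarrow> bool" where
  "affinely_isomorphic S T \<longleftrightarrow> (\<exists>h. affine_map_on UNIV h \<and> bij_betw h S T)"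

section \<open>R^k as functions nat \<Rightarrow> real supported on {1..k}\<close>

definition unitv :: "nat \<Rightarrow> nat \<Rightarrow> real" where
  "unitv i = (\<lambda>j. if j = i then 1 else 0)"

definition cube_std :: "nat \<Rightarrow> (nat \<Rightarrow> real) set" where
  "cube_std m = convex hull {a. (\<forall>i\<in>{1..m}. a i = 1 \<or> a i = -1) \<and> (\<forall>i. i \<notin> {1..m} \<longrightarrow> a i = 0)}"

definition simplex_std :: "nat \<Rightarrow> (nat \<Rightarrow> real) set" where
  "simplex_std n = convex hull (insert 0 {unitv i | i. i \<in> {1..n}})"

section \<open>R^{n+nm} with basis e_i (Inl i) and e_ik (Inr (i,k))\<close>

definition eS :: "nat \<Rightarrow> nat + nat \<times> nat \<Rightarrow> real" where
  "eS i = (\<lambda>z. if z = Inl i then 1 else 0)"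

definition eD :: "nat \<Rightarrow> nat \<Rightarrow> nat + nat \<times> nat \<Rightarrow> real" where
  "eD i k = (\<lambda>z. if z = Inr (i, k) then 1 else 0)"

definition hom_pts :: "nat \<Rightarrow> nat \<Rightarrow> (nat + nat \<times> nat \<Rightarrow> real) set" where
  "hom_pts n m =
     {0}
     \<union> {2 *\<^sub>R eS i | i. i \<in> {1..n}}
     \<union> {eS i + eD i k | i k. i \<in> {1..n} \<and> k \<in> {1..m}}
     \<union> {eS i - eD i k | i k. i \<in> {1..n} \<and> k \<in> {1..m}}
     \<union> {(eS i + eS j) + (eD i k - eD j k) | i j k. i \<in> {1..n} \<and> j \<in> {1..n} \<and> i \<noteq> j \<and> k \<in> {1..m}}"

end

theory Submission
  imports Defs
begin

text \<open>An affine map \<open>f : \<box>\<^sub>m \<rightarrow> \<triangle>\<^sub>n\<close> is determined by \<open>c = f 0\<close> and \<open>d\<^sub>k = f e\<^sub>k - f 0\<close>.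
  Recording \<open>(2c, 2d)\<close> identifies \<open>Hom(\<box>\<^sub>m, \<triangle>\<^sub>n)\<close> linearly with the polytope of those
  points whose induced map sends every vertex of the cube into the simplex. This polytope is the
  convex hull of \<open>hom_pts\<close>: the listed points satisfy its inequalities, and conversely every point
  splits column by column, the positive entries of a column being paired with the negative ones via
  \<open>e\<^sub>i + e\<^sub>j + e\<^sub>i\<^sub>k - e\<^sub>j\<^sub>k\<close>, the unmatched rest via \<open>e\<^sub>i \<plusminus> e\<^sub>i\<^sub>k\<close>, and the remaining mass
  on \<open>e\<^sub>i\<close> via \<open>2e\<^sub>i\<close>. Each listed point is cut off from the others by a linear functional,
  so all of them are vertices, and there are \<open>1 + n + 2nm + n(n - 1)m = (n + 1)(mn + 1)\<close> of them.\<close>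

section \<open>Affine maps, convex hulls and extreme points\<close>

lemma sum_fun_apply: "(sum F I) z = (\<Sum>i\<in>I. F i z)"
  by (induction I rule: infinite_finite_induct) auto

lemma scaleR_fun_apply [simp]: "(c *\<^sub>R f) x = c *\<^sub>R f x"
  by (simp add: scaleR_fun_def)

lemma linear_imp_affine_map_on: "linear h \<Longrightarrow> affine_map_on A h"
  by (simp add: affine_map_on_def linear_add linear_scale)

lemma affine_map_on_scaleR:
  assumes "affine_map_on A g" "0 \<in> A" "x \<in> A"
  shows "g (t *\<^sub>R x) = g 0 + t *\<^sub>R (g x - g 0)"
proof -
  have "g ((1 - t) *\<^sub>R 0 + t *\<^sub>R x) = (1 - t) *\<^sub>R g 0 + t *\<^sub>R g x"
    using assms unfolding affine_map_on_def by blast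
  then show ?thesis by (simp add: algebra_simps)
qed

lemma affine_map_on_add:
  assumes "subspace A" "affine_map_on A g" "x \<in> A" "y \<in> A"
  shows "g (x + y) = g x + g y - g 0"
proof -
  define z where "z = (1 - 1/2) *\<^sub>R x + (1/2) *\<^sub>R y"
  have "z \<in> A"
    unfolding z_def using assms by (intro subspace_add subspace_scale)
  have gz: "g z = (1 - 1/2) *\<^sub>R g x + (1/2) *\<^sub>R g y"
    using assms unfolding affine_map_on_def z_def by blast
  have "g (x + y) = g (2 *\<^sub>R z)"
    by (simp add: z_def scaleR_add_right)
  also have "\<dots> = g 0 + 2 *\<^sub>R (g z - g 0)"
    using affine_map_on_scaleR[OF assms(2) subspace_0[OF assms(1)] \<open>z \<in> A\<close>] .
  also have "\<dots> = g x + g y - g 0"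
    by (simp add: gz algebra_simps scaleR_2)
  finally show ?thesis .
qed

lemma affine_map_on_sum:
  assumes "subspace A" "affine_map_on A g" "finite I" "\<And>i. i \<in> I \<Longrightarrow> v i \<in> A"
  shows "g (\<Sum>i\<in>I. a i *\<^sub>R v i) = g 0 + (\<Sum>i\<in>I. a i *\<^sub>R (g (v i) - g 0))"
  using assms(3,4)
proof (induction I rule: finite_induct)
  case (insert i I)
  have "a i *\<^sub>R v i \<in> A" "(\<Sum>i\<in>I. a i *\<^sub>R v i) \<in> A"
    using insert assms(1) by (auto intro: subspace_scale subspace_sum)
  then show ?case
    using insert affine_map_on_add[OF assms(1,2)]
      affine_map_on_scaleR[OF assms(2) subspace_0[OF assms(1)], of "v i" "a i"]
    by simp
qed simp

lemma affine_map_on_image_convex_hull_subset: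
  assumes "affine A" "affine_map_on A g" "S \<subseteq> A" "g ` S \<subseteq> T" "convex T"
  shows "g ` (convex hull S) \<subseteq> T"
proof -
  have "convex {x \<in> A. g x \<in> T}"
    unfolding convex_alt
  proof (intro ballI allI impI)
    fix x y and u :: real
    assume x: "x \<in> {x \<in> A. g x \<in> T}" and y: "y \<in> {x \<in> A. g x \<in> T}" and u: "0 \<le> u \<and> u \<le> 1"
    have "(1 - u) *\<^sub>R x + u *\<^sub>R y \<in> A"
      using assms(1) x y unfolding affine_alt by blast
    moreover have "g ((1 - u) *\<^sub>R x + u *\<^sub>R y) = (1 - u) *\<^sub>R g x + u *\<^sub>R g y"
      using assms(2) x y unfolding affine_map_on_def by blast
    moreover have "(1 - u) *\<^sub>R g x + u *\<^sub>R g y \<in> T"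
      using assms(5) x y u unfolding convex_alt by blast
    ultimately show "(1 - u) *\<^sub>R x + u *\<^sub>R y \<in> {x \<in> A. g x \<in> T}" by simp
  qed
  then have "convex hull S \<subseteq> {x \<in> A. g x \<in> T}"
    using assms(3,4) by (intro hull_minimal) auto
  then show ?thesis by auto
qed

lemma extreme_points_of_inj_linear_image:
  assumes "linear h" "inj_on h S" "convex S"
  shows "{y. y extreme_point_of (h ` S)} = h ` {x. x extreme_point_of S}"
proof -
  have open_segment_image: "h x \<in> open_segment (h a) (h b) \<longleftrightarrow> x \<in> open_segment a b"
    if S: "x \<in> S" "a \<in> S" "b \<in> S" for x a b
  proof -
    have comb: "h ((1 - u) *\<^sub>R a + u *\<^sub>R b) = (1 - u) *\<^sub>R h a + u *\<^sub>R h b" for u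
      using assms(1) by (simp add: linear_add linear_scale)
    have "h x = (1 - u) *\<^sub>R h a + u *\<^sub>R h b \<longleftrightarrow> x = (1 - u) *\<^sub>R a + u *\<^sub>R b"
      if "0 \<le> u" "u \<le> 1" for u
    proof -
      have "(1 - u) *\<^sub>R a + u *\<^sub>R b \<in> S"
        using assms(3) S that by (simp add: convex_alt)
      then show ?thesis
        using assms(2) S comb[of u] by (metis inj_on_def)
    qed
    moreover have "h x = h a \<longleftrightarrow> x = a" "h x = h b \<longleftrightarrow> x = b"
      using assms(2) S by (auto dest: inj_onD)
    ultimately show ?thesis
      unfolding open_segment_def closed_segment_def by auto
  qed
  have "y extreme_point_of (h ` S) \<longleftrightarrow> (\<exists>x. y = h x \<and> x extreme_point_of S)" for y
    unfolding extreme_point_of_def by (auto simp: open_segment_image)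
  then show ?thesis by blast
qed

section \<open>The cube and the simplex in coordinates\<close>

definition coord_space :: "nat \<Rightarrow> (nat \<Rightarrow> real) set" where
  "coord_space N = {x. \<forall>j. j \<notin> {1..N} \<longrightarrow> x j = 0}"

lemma subspace_coord_space: "subspace (coord_space N)"
  unfolding subspace_def coord_space_def by auto

lemma zero_in_coord_space [simp]: "0 \<in> coord_space N"
  by (simp add: coord_space_def)

lemma unitv_in_coord_space: "k \<in> {1..N} \<Longrightarrow> unitv k \<in> coord_space N"
  by (auto simp: coord_space_def unitv_def)

lemma coord_space_expand:
  assumes "x \<in> coord_space N"
  shows "x = (\<Sum>k\<in>{1..N}. x k *\<^sub>R unitv k)"
proof
  fix j
  have "(\<Sum>k\<in>{1..N}. x k *\<^sub>R unitv k) j = (\<Sum>k\<in>{1..N}. if j = k then x k else 0)"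
    unfolding sum_fun_apply by (rule sum.cong) (auto simp: unitv_def)
  also have "\<dots> = x j"
    using assms by (simp add: sum.delta coord_space_def)
  finally show "x j = (\<Sum>k\<in>{1..N}. x k *\<^sub>R unitv k) j" by simp
qed

lemma affine_hull_eq_coord_space:
  assumes "S \<subseteq> coord_space N" "0 \<in> S" "\<And>k. k \<in> {1..N} \<Longrightarrow> unitv k \<in> S"
  shows "affine hull S = coord_space N"
proof -
  have "affine hull S = span S"
    by (rule affine_hull_span_0) (rule hull_inc[OF assms(2)])
  also have "\<dots> = coord_space N"
  proof
    show "span S \<subseteq> coord_space N"
      by (rule span_minimal[OF assms(1) subspace_coord_space])
    show "coord_space N \<subseteq> span S"
    proof
      fix x assume "x \<in> coord_space N"
      moreover have "(\<Sum>k\<in>{1..N}. x k *\<^sub>R unitv k) \<in> span S"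
        using assms(3) by (intro span_sum span_scale span_base) auto
      ultimately show "x \<in> span S"
        using coord_space_expand by metis
    qed
  qed
  finally show ?thesis .
qed

definition sign_vectors :: "nat \<Rightarrow> (nat \<Rightarrow> real) set" where
  "sign_vectors m = {a. (\<forall>i\<in>{1..m}. a i = 1 \<or> a i = -1) \<and> (\<forall>i. i \<notin> {1..m} \<longrightarrow> a i = 0)}"

lemma cube_std_eq_convex_hull: "cube_std m = convex hull sign_vectors m"
  by (simp add: cube_std_def sign_vectors_def)

lemma sign_vectors_subset_coord_space: "sign_vectors m \<subseteq> coord_space m"
  by (auto simp: sign_vectors_def coord_space_def)

lemma midpoint_sign_vectors_in_cube_std:
  assumes "s \<in> sign_vectors m" "t \<in> sign_vectors m"
  shows "(1/2) *\<^sub>R s + (1/2) *\<^sub>R t \<in> cube_std m"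
  using assms unfolding cube_std_eq_convex_hull
  by (intro convexD[OF convex_convex_hull] hull_inc) auto

lemma affine_hull_cube_std: "affine hull cube_std m = coord_space m"
proof (rule affine_hull_eq_coord_space)
  show "cube_std m \<subseteq> coord_space m"
    unfolding cube_std_eq_convex_hull
    by (intro hull_minimal sign_vectors_subset_coord_space subspace_imp_convex subspace_coord_space)
  define s where "s = (\<lambda>i::nat. if i \<in> {1..m} then 1 else (0::real))"
  have "s \<in> sign_vectors m" "- s \<in> sign_vectors m"
    by (auto simp: s_def sign_vectors_def)
  from midpoint_sign_vectors_in_cube_std[OF this] show "0 \<in> cube_std m"
    by (simp add: scaleR_minus_right)
  fix k assume k: "k \<in> {1..m}"
  define t where "t = (\<lambda>i::nat. if i \<in> {1..m} then (if i = k then 1 else -1) else (0::real))"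
  have "t \<in> sign_vectors m"
    by (auto simp: t_def sign_vectors_def)
  moreover have "(1/2) *\<^sub>R s + (1/2) *\<^sub>R t = unitv k"
    using k by (auto simp: s_def t_def unitv_def)
  ultimately show "unitv k \<in> cube_std m"
    using midpoint_sign_vectors_in_cube_std \<open>s \<in> sign_vectors m\<close> by metis
qed

lemma simplex_std_eq:
  "simplex_std n = {y \<in> coord_space n. (\<forall>j\<in>{1..n}. 0 \<le> y j) \<and> (\<Sum>j\<in>{1..n}. y j) \<le> 1}"
  (is "_ = ?D")
proof
  have "convex ?D"
    unfolding convex_def
  proof (intro ballI allI impI)
    fix x y and u v :: real assume xy: "x \<in> ?D" "y \<in> ?D" and uv: "0 \<le> u" "0 \<le> v" "u + v = 1"
    have "(\<Sum>j\<in>{1..n}. u * x j + v * y j) = u * (\<Sum>j\<in>{1..n}. x j) + v * (\<Sum>j\<in>{1..n}. y j)"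
      by (simp add: sum.distrib sum_distrib_left)
    also have "\<dots> \<le> u * 1 + v * 1"
      using xy uv by (intro add_mono mult_left_mono) auto
    finally show "u *\<^sub>R x + v *\<^sub>R y \<in> ?D"
      using xy uv by (auto simp: coord_space_def)
  qed
  moreover have "insert 0 {unitv i | i. i \<in> {1..n}} \<subseteq> ?D"
    by (auto simp: coord_space_def unitv_def)
  ultimately show "simplex_std n \<subseteq> ?D"
    unfolding simplex_std_def by (rule hull_minimal[rotated])
  show "?D \<subseteq> simplex_std n"
  proof
    fix y assume y: "y \<in> ?D"
    define w where "w j = (if j = 0 then 0 else unitv j)" for j
    define a where "a j = (if j = 0 then 1 - (\<Sum>j\<in>{1..n}. y j) else y j)" for j
    have I: "{0..n} = insert 0 {1..n}" by auto
    have "(\<Sum>j\<in>{0..n}. a j *\<^sub>R w j) \<in> simplex_std n"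
      unfolding simplex_std_def
    proof (rule convex_sum)
      show "sum a {0..n} = 1"
        unfolding I by (simp add: a_def)
      show "\<And>j. j \<in> {0..n} \<Longrightarrow> 0 \<le> a j"
        using y by (auto simp: a_def)
      show "\<And>j. j \<in> {0..n} \<Longrightarrow> w j \<in> convex hull insert 0 {unitv i |i. i \<in> {1..n}}"
        by (rule hull_inc) (auto simp: w_def)
    qed auto
    moreover have "(\<Sum>j\<in>{0..n}. a j *\<^sub>R w j) = (\<Sum>j\<in>{1..n}. y j *\<^sub>R unitv j)"
      unfolding I by (simp add: a_def w_def)
    ultimately show "y \<in> simplex_std n"
      using coord_space_expand[of y n] y by simp
  qed
qed

lemma affine_hull_simplex_std: "affine hull simplex_std n = coord_space n"
proof (rule affine_hull_eq_coord_space)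
  show "simplex_std n \<subseteq> coord_space n"
    by (auto simp: simplex_std_eq)
qed (auto simp: simplex_std_def intro: hull_inc)

lemma mem_Hom_cube_simplex_iff:
  "f \<in> Hom (cube_std m) (simplex_std n) \<longleftrightarrow>
     affine_map_on (coord_space m) f \<and> f ` coord_space m \<subseteq> coord_space n
     \<and> f ` cube_std m \<subseteq> simplex_std n \<and> (\<forall>x. x \<notin> coord_space m \<longrightarrow> f x = 0)"
  unfolding Hom_def affine_hull_cube_std affine_hull_simplex_std by simp

section \<open>Coordinates on \<open>Hom(\<box>\<^sub>m, \<triangle>\<^sub>n)\<close>\<close>

lemma eS_apply [simp]: "eS i (Inl j) = (if j = i then 1 else 0)" "eS i (Inr jk) = 0"
  by (simp_all add: eS_def)

lemma eD_apply [simp]: "eD i k (Inl j) = 0" "eD i k (Inr (j, l)) = (if j = i \<and> l = k then 1 else 0)"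
  by (auto simp: eD_def)

definition valid_index :: "nat \<Rightarrow> nat \<Rightarrow> nat + nat \<times> nat \<Rightarrow> bool" where
  "valid_index n m z = (case z of Inl i \<Rightarrow> i \<in> {1..n} | Inr (i, k) \<Rightarrow> i \<in> {1..n} \<and> k \<in> {1..m})"

text \<open>The affine map \<open>x \<mapsto> c + \<Sum>\<^sub>k x\<^sub>k d\<^sub>k\<close> gets the coordinates \<open>2c\<^sub>i\<close> at \<open>e\<^sub>i\<close> and
  \<open>2d\<^sub>k\<^sub>,\<^sub>i\<close> at \<open>e\<^sub>i\<^sub>k\<close>; the factor 2 puts the vertices on the points of \<open>hom_pts\<close>.
  Conversely \<open>coord_eval m p x j\<close> is twice the \<open>j\<close>-th coordinate of the image of \<open>x\<close>.\<close>
definition hom_coords :: "nat \<Rightarrow> nat \<Rightarrow> ((nat \<Rightarrow> real) \<Rightarrow> nat \<Rightarrow> real) \<Rightarrow> nat + nat \<times> nat \<Rightarrow> real" where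
  "hom_coords n m f = (\<lambda>z. case z of
      Inl i \<Rightarrow> if i \<in> {1..n} then 2 * f 0 i else 0
    | Inr (i, k) \<Rightarrow> if i \<in> {1..n} \<and> k \<in> {1..m} then 2 * (f (unitv k) i - f 0 i) else 0)"

definition coord_eval :: "nat \<Rightarrow> (nat + nat \<times> nat \<Rightarrow> real) \<Rightarrow> (nat \<Rightarrow> real) \<Rightarrow> nat \<Rightarrow> real" where
  "coord_eval m p x j = p (Inl j) + (\<Sum>k\<in>{1..m}. x k * p (Inr (j, k)))"

definition hom_of_coords :: "nat \<Rightarrow> nat \<Rightarrow> (nat + nat \<times> nat \<Rightarrow> real) \<Rightarrow> (nat \<Rightarrow> real) \<Rightarrow> nat \<Rightarrow> real" where
  "hom_of_coords n m p x =
     (if x \<in> coord_space m then (\<lambda>j. if j \<in> {1..n} then coord_eval m p x j / 2 else 0) else 0)"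

definition hom_polytope :: "nat \<Rightarrow> nat \<Rightarrow> (nat + nat \<times> nat \<Rightarrow> real) set" where
  "hom_polytope n m = {p. (\<forall>z. \<not> valid_index n m z \<longrightarrow> p z = 0) \<and>
      (\<forall>s\<in>sign_vectors m. (\<forall>j\<in>{1..n}. 0 \<le> coord_eval m p s j) \<and> (\<Sum>j\<in>{1..n}. coord_eval m p s j) \<le> 2)}"

lemma coord_eval_add [simp]: "coord_eval m (p + q) x j = coord_eval m p x j + coord_eval m q x j"
  by (simp add: coord_eval_def sum.distrib algebra_simps)

lemma coord_eval_scaleR [simp]: "coord_eval m (c *\<^sub>R p) x j = c * coord_eval m p x j"
  by (simp add: coord_eval_def sum_distrib_left algebra_simps)

lemma coord_eval_diff [simp]: "coord_eval m (p - q) x j = coord_eval m p x j - coord_eval m q x j"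
  by (simp add: coord_eval_def sum_subtractf algebra_simps)

lemma coord_eval_eS [simp]: "coord_eval m (eS i) x j = (if j = i then 1 else 0)"
  by (simp add: coord_eval_def)

lemma coord_eval_zero [simp]: "coord_eval m 0 x j = 0"
  by (simp add: coord_eval_def)

lemma coord_eval_eD [simp]: "coord_eval m (eD i k) x j = (if j = i \<and> k \<in> {1..m} then x k else 0)"
proof -
  have "coord_eval m (eD i k) x j = (\<Sum>l\<in>{1..m}. if l = k then (if j = i then x k else 0) else 0)"
    unfolding coord_eval_def eD_apply(1) add_0_left by (rule sum.cong) auto
  then show ?thesis by simp
qed

lemma coord_eval_affine:
  "coord_eval m p ((1 - u) *\<^sub>R x + u *\<^sub>R y) j = (1 - u) * coord_eval m p x j + u * coord_eval m p y j"
proof -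
  have "(\<Sum>k\<in>{1..m}. ((1 - u) * x k + u * y k) * p (Inr (j, k)))
      = (1 - u) * (\<Sum>k\<in>{1..m}. x k * p (Inr (j, k))) + u * (\<Sum>k\<in>{1..m}. y k * p (Inr (j, k)))"
    by (simp add: sum.distrib sum_distrib_left distrib_right mult.assoc)
  then show ?thesis
    by (simp add: coord_eval_def algebra_simps)
qed

lemma coord_eval_origin: "coord_eval m p 0 j = p (Inl j)"
  by (simp add: coord_eval_def)

lemma coord_eval_unitv: "k \<in> {1..m} \<Longrightarrow> coord_eval m p (unitv k) j = p (Inl j) + p (Inr (j, k))"
  by (simp add: coord_eval_def unitv_def if_distrib[of "\<lambda>a. a * _"] sum.delta cong: if_cong)

lemma linear_hom_coords: "linear (hom_coords n m)"
  by (rule linearI) (auto simp: hom_coords_def fun_eq_iff algebra_simps split: sum.split)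

lemma linear_hom_of_coords: "linear (hom_of_coords n m)"
  by (rule linearI) (auto simp: hom_of_coords_def fun_eq_iff add_divide_distrib)

lemma convex_simplex_std: "convex (simplex_std n)"
  by (simp add: simplex_std_def)

lemma hom_of_coords_mem_Hom:
  assumes "p \<in> hom_polytope n m"
  shows "hom_of_coords n m p \<in> Hom (cube_std m) (simplex_std n)"
proof -
  have affine: "affine_map_on (coord_space m) (hom_of_coords n m p)"
    unfolding affine_map_on_def
  proof (intro ballI allI)
    fix x y and u :: real assume "x \<in> coord_space m" "y \<in> coord_space m"
    moreover from this have "(1 - u) *\<^sub>R x + u *\<^sub>R y \<in> coord_space m"
      using subspace_coord_space by (intro subspace_add subspace_scale)
    ultimately show "hom_of_coords n m p ((1 - u) *\<^sub>R x + u *\<^sub>R y)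
        = (1 - u) *\<^sub>R hom_of_coords n m p x + u *\<^sub>R hom_of_coords n m p y"
      using coord_eval_affine[of m p u x y] by (auto simp: hom_of_coords_def fun_eq_iff field_simps)
  qed
  have "hom_of_coords n m p ` sign_vectors m \<subseteq> simplex_std n"
  proof clarify
    fix s assume s: "s \<in> sign_vectors m"
    then have "(\<Sum>j\<in>{1..n}. coord_eval m p s j / 2) \<le> 1"
      using assms by (auto simp: hom_polytope_def simp flip: sum_divide_distrib)
    then show "hom_of_coords n m p s \<in> simplex_std n"
      using s assms sign_vectors_subset_coord_space
      by (auto simp: hom_polytope_def hom_of_coords_def simplex_std_eq coord_space_def)
  qed
  then have "hom_of_coords n m p ` cube_std m \<subseteq> simplex_std n"
    unfolding cube_std_eq_convex_hull
    by (rule affine_map_on_image_convex_hull_subset[OF subspace_imp_affine[OF subspace_coord_space]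
        affine sign_vectors_subset_coord_space _ convex_simplex_std])
  moreover have "hom_of_coords n m p ` coord_space m \<subseteq> coord_space n"
    by (auto simp: hom_of_coords_def coord_space_def)
  ultimately show ?thesis
    using affine by (simp add: mem_Hom_cube_simplex_iff hom_of_coords_def)
qed

lemma hom_coords_hom_of_coords:
  assumes "p \<in> hom_polytope n m"
  shows "hom_coords n m (hom_of_coords n m p) = p"
proof
  fix z
  have "p z = 0" if "\<not> valid_index n m z"
    using assms that by (simp add: hom_polytope_def)
  then show "hom_coords n m (hom_of_coords n m p) z = p z"
    by (auto simp: hom_coords_def hom_of_coords_def valid_index_def coord_eval_origin coord_eval_unitv
        unitv_in_coord_space add_divide_distrib split: sum.split)
qed

lemma Hom_cube_apply:
  assumes "f \<in> Hom (cube_std m) (simplex_std n)" "x \<in> coord_space m"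
  shows "f x = f 0 + (\<Sum>k\<in>{1..m}. x k *\<^sub>R (f (unitv k) - f 0))"
proof -
  have "f (\<Sum>k\<in>{1..m}. x k *\<^sub>R unitv k) = f 0 + (\<Sum>k\<in>{1..m}. x k *\<^sub>R (f (unitv k) - f 0))"
    using assms(1)
    by (intro affine_map_on_sum[OF subspace_coord_space])
      (auto simp: mem_Hom_cube_simplex_iff unitv_in_coord_space)
  then show ?thesis
    using coord_space_expand[OF assms(2)] by simp
qed

lemma hom_of_coords_hom_coords:
  assumes f: "f \<in> Hom (cube_std m) (simplex_std n)"
  shows "hom_of_coords n m (hom_coords n m f) = f"
proof
  fix x
  show "hom_of_coords n m (hom_coords n m f) x = f x"
  proof (cases "x \<in> coord_space m")
    case True
    have "coord_eval m (hom_coords n m f) x j = 2 * f x j" if "j \<in> {1..n}" for j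
    proof -
      have "coord_eval m (hom_coords n m f) x j = 2 * f 0 j + (\<Sum>k\<in>{1..m}. x k * (2 * (f (unitv k) j - f 0 j)))"
        unfolding coord_eval_def using that by (auto simp: hom_coords_def intro!: sum.cong)
      also have "\<dots> = 2 * f x j"
        using Hom_cube_apply[OF f True] by (simp add: sum_fun_apply sum_distrib_left algebra_simps)
      finally show ?thesis .
    qed
    moreover have "f x j = 0" if "j \<notin> {1..n}" for j
      using f True that by (auto simp: mem_Hom_cube_simplex_iff coord_space_def)
    ultimately show ?thesis
      using True by (auto simp: hom_of_coords_def)
  next
    case False
    then show ?thesis
      using f by (simp add: hom_of_coords_def mem_Hom_cube_simplex_iff)
  qed
qed

lemma hom_coords_mem_hom_polytope:
  assumes f: "f \<in> Hom (cube_std m) (simplex_std n)"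
  shows "hom_coords n m f \<in> hom_polytope n m"
proof -
  have "coord_eval m (hom_coords n m f) s j = 2 * f s j" if "s \<in> sign_vectors m" "j \<in> {1..n}" for s j
  proof -
    have "f s = hom_of_coords n m (hom_coords n m f) s"
      by (simp add: hom_of_coords_hom_coords[OF f])
    then show ?thesis
      using that sign_vectors_subset_coord_space by (auto simp: hom_of_coords_def)
  qed
  moreover have "f s \<in> simplex_std n" if "s \<in> sign_vectors m" for s
  proof -
    have "s \<in> cube_std m"
      using that by (simp add: cube_std_eq_convex_hull hull_inc)
    then show ?thesis
      using f by (auto simp: mem_Hom_cube_simplex_iff)
  qed
  moreover have "hom_coords n m f z = 0" if "\<not> valid_index n m z" for z
    using that by (auto simp: hom_coords_def valid_index_def split: sum.split)
  ultimately show ?thesis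
    by (auto simp: hom_polytope_def simplex_std_eq simp flip: sum_distrib_left)
qed

lemma bij_betw_hom_coords:
  "bij_betw (hom_coords n m) (Hom (cube_std m) (simplex_std n)) (hom_polytope n m)"
  by (rule bij_betw_byWitness[where f' = "hom_of_coords n m"])
    (auto simp: hom_of_coords_hom_coords hom_coords_hom_of_coords
      intro: hom_coords_mem_hom_polytope hom_of_coords_mem_Hom)

lemma bij_betw_hom_of_coords:
  "bij_betw (hom_of_coords n m) (hom_polytope n m) (Hom (cube_std m) (simplex_std n))"
  by (rule bij_betw_byWitness[where f' = "hom_coords n m"])
    (auto simp: hom_of_coords_hom_coords hom_coords_hom_of_coords
      intro: hom_coords_mem_hom_polytope hom_of_coords_mem_Hom)

section \<open>The coordinate polytope is the convex hull of \<open>hom_pts\<close>\<close>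

lemma convex_hom_polytope: "convex (hom_polytope n m)"
  unfolding convex_def
proof (intro ballI allI impI)
  fix p q and u v :: real
  assume pq: "p \<in> hom_polytope n m" "q \<in> hom_polytope n m" and uv: "0 \<le> u" "0 \<le> v" "u + v = 1"
  have "(\<Sum>j\<in>{1..n}. coord_eval m (u *\<^sub>R p + v *\<^sub>R q) s j) \<le> 2" if "s \<in> sign_vectors m" for s
  proof -
    have "(\<Sum>j\<in>{1..n}. coord_eval m (u *\<^sub>R p + v *\<^sub>R q) s j)
        = u * (\<Sum>j\<in>{1..n}. coord_eval m p s j) + v * (\<Sum>j\<in>{1..n}. coord_eval m q s j)"
      by (simp add: sum.distrib sum_distrib_left)
    also have "\<dots> \<le> u * 2 + v * 2"
      using pq that uv by (intro add_mono mult_left_mono) (auto simp: hom_polytope_def)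
    finally show ?thesis
      using uv by (simp add: algebra_simps)
  qed
  then show "u *\<^sub>R p + v *\<^sub>R q \<in> hom_polytope n m"
    using pq uv by (auto simp: hom_polytope_def)
qed

lemma sign_vector_bounds: "s \<in> sign_vectors m \<Longrightarrow> k \<in> {1..m} \<Longrightarrow> -1 \<le> s k \<and> s k \<le> 1"
  by (force simp: sign_vectors_def)

lemma hom_pts_subset_hom_polytope: "hom_pts n m \<subseteq> hom_polytope n m"
proof
  fix p assume "p \<in> hom_pts n m"
  then show "p \<in> hom_polytope n m"
    unfolding hom_pts_def
  proof (elim UnE CollectE exE conjE insertE)
    fix i assume "p = 2 *\<^sub>R eS i" "i \<in> {1..n}"
    then show ?thesis
      by (auto simp: hom_polytope_def valid_index_def simp flip: sum_distrib_left split: sum.splits)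
  next
    fix i k assume "p = eS i + eD i k" "i \<in> {1..n}" "k \<in> {1..m}"
    then show ?thesis
      by (auto simp: hom_polytope_def valid_index_def sum.distrib split: sum.splits
          dest!: sign_vector_bounds[of _ m k])
  next
    fix i k assume "p = eS i - eD i k" "i \<in> {1..n}" "k \<in> {1..m}"
    then show ?thesis
      by (auto simp: hom_polytope_def valid_index_def sum.distrib sum_subtractf split: sum.splits
          dest!: sign_vector_bounds[of _ m k])
  next
    fix i j k assume "p = (eS i + eS j) + (eD i k - eD j k)" "i \<in> {1..n}" "j \<in> {1..n}" "i \<noteq> j" "k \<in> {1..m}"
    then show ?thesis
      by (auto simp: hom_polytope_def valid_index_def sum.distrib sum_subtractf split: sum.splits
          dest!: sign_vector_bounds[of _ m k])
  qed (auto simp: hom_polytope_def valid_index_def split: sum.splits)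
qed

lemma convex_hull_hom_pts_subset: "convex hull hom_pts n m \<subseteq> hom_polytope n m"
  by (rule hull_minimal[of _ _ convex, OF hom_pts_subset_hom_polytope convex_hom_polytope])

lemma scaleR_image_convex_add:
  assumes "convex C" "0 \<le> a" "0 \<le> b" "u \<in> (*\<^sub>R) a ` C" "v \<in> (*\<^sub>R) b ` C"
  shows "u + v \<in> (*\<^sub>R) (a + b) ` C"
proof -
  obtain q r where qr: "q \<in> C" "r \<in> C" "u = a *\<^sub>R q" "v = b *\<^sub>R r"
    using assms(4,5) by blast
  show ?thesis
  proof (cases "a + b = 0")
    case True
    then have "a = 0" "b = 0"
      using assms(2,3) by linarith+
    then have "u + v = (a + b) *\<^sub>R q"
      using qr by simp
    then show ?thesis
      using qr(1) by blast
  next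
    case False
    then have "a + b > 0"
      using assms(2,3) by simp
    define c where "c = (a / (a + b)) *\<^sub>R q + (b / (a + b)) *\<^sub>R r"
    have "c \<in> C"
      unfolding c_def using assms(1-3) qr(1,2) \<open>a + b > 0\<close>
      by (intro convexD) (auto simp: add_divide_distrib[symmetric])
    moreover have "u + v = (a + b) *\<^sub>R c"
      using \<open>a + b > 0\<close> by (simp add: qr c_def scaleR_add_right)
    ultimately show ?thesis by blast
  qed
qed

lemma scaleR_image_convex_sum:
  assumes "convex C" "0 \<in> C" "\<And>i. i \<in> I \<Longrightarrow> 0 \<le> w i" "\<And>i. i \<in> I \<Longrightarrow> v i \<in> (*\<^sub>R) (w i) ` C"
  shows "sum v I \<in> (*\<^sub>R) (sum w I) ` C"
proof (cases "finite I")
  case True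
  then show ?thesis
    using assms(3,4)
  proof (induction I rule: finite_induct)
    case empty
    then show ?case
      using assms(2) by force
  next
    case (insert i I)
    then show ?case
      by (simp add: scaleR_image_convex_add[OF assms(1)] sum_nonneg)
  qed
qed (use assms(2) in force)

lemma scaleR_image_convex_mono:
  assumes "convex C" "0 \<in> C" "0 \<le> a" "a \<le> b"
  shows "(*\<^sub>R) a ` C \<subseteq> (*\<^sub>R) b ` C"
proof
  fix u assume "u \<in> (*\<^sub>R) a ` C"
  moreover have "0 \<in> (*\<^sub>R) (b - a) ` C"
    using assms(2) by force
  ultimately have "u + 0 \<in> (*\<^sub>R) (a + (b - a)) ` C"
    using assms by (intro scaleR_image_convex_add) auto
  then show "u \<in> (*\<^sub>R) b ` C" by simp
qed

lemma scaleR_mem_scaleR_image: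
  fixes C :: "'a::real_vector set"
  assumes "0 \<in> C" "q \<in> C \<or> t = 0"
  shows "t *\<^sub>R q \<in> (*\<^sub>R) t ` C"
proof (cases "t = 0")
  case True
  then have "t *\<^sub>R q = t *\<^sub>R 0"
    by simp
  then show ?thesis
    using assms(1) by blast
qed (use assms in auto)

lemma split_weights_sum_eq_max:
  fixes A B :: real
  assumes "0 \<le> A" "0 \<le> B"
  shows "A * B / max A B + A * (1 - B / max A B) + B * (1 - A / max A B) = max A B"
  using assms by (cases "A \<le> B"; cases "B = 0"; simp add: max_def field_simps)

lemma sum_pairing_eq:
  fixes a b :: "'i \<Rightarrow> real" and u v :: "'i \<Rightarrow> 'a::real_vector"
  shows "(\<Sum>i\<in>I. \<Sum>j\<in>I. (a i * b j / M) *\<^sub>R (u i + v j))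
      + (\<Sum>i\<in>I. (a i * (1 - sum b I / M)) *\<^sub>R u i) + (\<Sum>i\<in>I. (b i * (1 - sum a I / M)) *\<^sub>R v i)
    = (\<Sum>i\<in>I. a i *\<^sub>R u i + b i *\<^sub>R v i)"
proof -
  have "(\<Sum>i\<in>I. \<Sum>j\<in>I. (a i * b j / M) *\<^sub>R (u i + v j))
      = (\<Sum>i\<in>I. \<Sum>j\<in>I. (a i * b j / M) *\<^sub>R u i) + (\<Sum>j\<in>I. \<Sum>i\<in>I. (a i * b j / M) *\<^sub>R v j)"
    by (simp add: scaleR_add_right sum.distrib) (rule sum.swap)
  also have "\<dots> = (\<Sum>i\<in>I. (a i * sum b I / M) *\<^sub>R u i) + (\<Sum>i\<in>I. (b i * sum a I / M) *\<^sub>R v i)"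
    by (simp add: sum_distrib_left sum_distrib_right sum_divide_distrib mult.commute flip: scaleR_sum_left)
  finally have "(\<Sum>i\<in>I. \<Sum>j\<in>I. (a i * b j / M) *\<^sub>R (u i + v j))
      + (\<Sum>i\<in>I. (a i * (1 - sum b I / M)) *\<^sub>R u i) + (\<Sum>i\<in>I. (b i * (1 - sum a I / M)) *\<^sub>R v i)
    = (\<Sum>i\<in>I. (a i * sum b I / M + a i * (1 - sum b I / M)) *\<^sub>R u i
        + (b i * sum a I / M + b i * (1 - sum a I / M)) *\<^sub>R v i)"
    by (simp add: scaleR_add_left sum.distrib add_ac)
  also have "\<dots> = (\<Sum>i\<in>I. a i *\<^sub>R u i + b i *\<^sub>R v i)"
    by (simp add: algebra_simps)
  finally show ?thesis .
qed

text \<open>Positive weights \<open>a\<close> are matched with negative weights \<open>b\<close> in proportion \<open>a\<^sub>i b\<^sub>j / M\<close>,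
  the unmatched rest is put on \<open>u\<^sub>i\<close> and \<open>v\<^sub>i\<close> alone.\<close>
lemma sum_pairing_mem_scaled_convex:
  fixes C :: "'a::real_vector set" and a b :: "'i \<Rightarrow> real"
  assumes C: "convex C" "0 \<in> C"
    and ab: "\<And>i. i \<in> I \<Longrightarrow> 0 \<le> a i \<and> 0 \<le> b i \<and> a i * b i = 0"
    and uv: "\<And>i. i \<in> I \<Longrightarrow> u i \<in> C \<and> v i \<in> C"
    and pairs: "\<And>i j. i \<in> I \<Longrightarrow> j \<in> I \<Longrightarrow> i \<noteq> j \<Longrightarrow> u i + v j \<in> C"
  shows "(\<Sum>i\<in>I. a i *\<^sub>R u i + b i *\<^sub>R v i) \<in> (*\<^sub>R) (max (sum a I) (sum b I)) ` C"
proof -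
  define M where "M = max (sum a I) (sum b I)"
  have "0 \<le> sum a I" "0 \<le> sum b I"
    using ab by (auto intro: sum_nonneg)
  then have "0 \<le> M" "sum a I / M \<le> 1" "sum b I / M \<le> 1"
    by (auto simp: M_def max_def divide_le_eq_1)
  then have weights: "0 \<le> a i * b j / M" "0 \<le> a i * (1 - sum b I / M)" "0 \<le> b i * (1 - sum a I / M)"
    if "i \<in> I" "j \<in> I" for i j
    using ab that by simp_all
  have "(\<Sum>i\<in>I. \<Sum>j\<in>I. (a i * b j / M) *\<^sub>R (u i + v j))
      \<in> (*\<^sub>R) (\<Sum>i\<in>I. \<Sum>j\<in>I. a i * b j / M) ` C"
  proof (intro scaleR_image_convex_sum[OF C] sum_nonneg scaleR_mem_scaleR_image[OF C(2)])
    fix i j assume "i \<in> I" "j \<in> I"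
    then show "u i + v j \<in> C \<or> a i * b j / M = 0"
      using ab[of i] pairs[of i j] by (cases "i = j") auto
  qed (use weights in auto)
  moreover have "(\<Sum>i\<in>I. (a i * (1 - sum b I / M)) *\<^sub>R u i) \<in> (*\<^sub>R) (\<Sum>i\<in>I. a i * (1 - sum b I / M)) ` C"
    "(\<Sum>i\<in>I. (b i * (1 - sum a I / M)) *\<^sub>R v i) \<in> (*\<^sub>R) (\<Sum>i\<in>I. b i * (1 - sum a I / M)) ` C"
    using uv weights by (auto intro!: scaleR_image_convex_sum[OF C])
  ultimately have "(\<Sum>i\<in>I. a i *\<^sub>R u i + b i *\<^sub>R v i) \<in> (*\<^sub>R) ((\<Sum>i\<in>I. \<Sum>j\<in>I. a i * b j / M)
      + (\<Sum>i\<in>I. a i * (1 - sum b I / M)) + (\<Sum>i\<in>I. b i * (1 - sum a I / M))) ` C"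
    unfolding sum_pairing_eq[symmetric, where M = M] using weights
    by (intro scaleR_image_convex_add[OF C(1)] add_nonneg_nonneg sum_nonneg) auto
  also have "(\<Sum>i\<in>I. \<Sum>j\<in>I. a i * b j / M) + (\<Sum>i\<in>I. a i * (1 - sum b I / M))
      + (\<Sum>i\<in>I. b i * (1 - sum a I / M)) = M"
  proof -
    have "(\<Sum>i\<in>I. \<Sum>j\<in>I. a i * b j / M) = sum a I * sum b I / M"
      by (simp add: sum_product sum_divide_distrib)
    moreover have "(\<Sum>i\<in>I. a i * (1 - sum b I / M)) = sum a I * (1 - sum b I / M)"
      "(\<Sum>i\<in>I. b i * (1 - sum a I / M)) = sum b I * (1 - sum a I / M)"
      by (simp_all add: sum_distrib_right)
    ultimately show ?thesis
      using split_weights_sum_eq_max[OF \<open>0 \<le> sum a I\<close> \<open>0 \<le> sum b I\<close>] by (simp add: M_def)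
  qed
  finally show ?thesis
    unfolding M_def .
qed

lemma max_sum_pos_neg_parts:
  fixes y :: "'i \<Rightarrow> real"
  shows "max (\<Sum>i\<in>I. max (y i) 0) (\<Sum>i\<in>I. max (- y i) 0) = ((\<Sum>i\<in>I. \<bar>y i\<bar>) + \<bar>\<Sum>i\<in>I. y i\<bar>) / 2"
proof -
  have "(\<Sum>i\<in>I. \<bar>y i\<bar>) = (\<Sum>i\<in>I. max (y i) 0 + max (- y i) 0)"
    "(\<Sum>i\<in>I. y i) = (\<Sum>i\<in>I. max (y i) 0 - max (- y i) 0)"
    by (rule sum.cong; simp)+
  then show ?thesis
    by (simp add: sum.distrib sum_subtractf max_def)
qed

lemma column_mem_scaled_convex_hull:
  fixes y :: "nat \<Rightarrow> real"
  assumes k: "k \<in> {1..m}"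
  shows "(\<Sum>i\<in>{1..n}. \<bar>y i\<bar> *\<^sub>R eS i + y i *\<^sub>R eD i k)
    \<in> (*\<^sub>R) (((\<Sum>i\<in>{1..n}. \<bar>y i\<bar>) + \<bar>\<Sum>i\<in>{1..n}. y i\<bar>) / 2) ` (convex hull hom_pts n m)"
proof -
  define a where "a i = max (y i) 0" for i
  define b where "b i = max (- y i) 0" for i
  have mem: "(\<Sum>i\<in>{1..n}. a i *\<^sub>R (eS i + eD i k) + b i *\<^sub>R (eS i - eD i k))
      \<in> (*\<^sub>R) (max (sum a {1..n}) (sum b {1..n})) ` (convex hull hom_pts n m)"
  proof (rule sum_pairing_mem_scaled_convex)
    show "convex (convex hull hom_pts n m)" "0 \<in> convex hull hom_pts n m"
      by (auto intro: hull_inc simp: hom_pts_def)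
    show "0 \<le> a i \<and> 0 \<le> b i \<and> a i * b i = 0" for i
      by (auto simp: a_def b_def)
    show "eS i + eD i k \<in> convex hull hom_pts n m \<and> eS i - eD i k \<in> convex hull hom_pts n m"
      if "i \<in> {1..n}" for i
      using that k by (auto intro!: hull_inc simp: hom_pts_def)
    show "(eS i + eD i k) + (eS j - eD j k) \<in> convex hull hom_pts n m"
      if "i \<in> {1..n}" "j \<in> {1..n}" "i \<noteq> j" for i j
    proof -
      have "(eS i + eS j) + (eD i k - eD j k) \<in> hom_pts n m"
        using that k unfolding hom_pts_def by blast
      then show ?thesis
        by (auto intro: hull_inc simp: algebra_simps)
    qed
  qed
  have vector: "a i *\<^sub>R (eS i + eD i k) + b i *\<^sub>R (eS i - eD i k) = \<bar>y i\<bar> *\<^sub>R eS i + y i *\<^sub>R eD i k" for i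
  proof -
    have "a i *\<^sub>R (eS i + eD i k) + b i *\<^sub>R (eS i - eD i k) = (a i + b i) *\<^sub>R eS i + (a i - b i) *\<^sub>R eD i k"
      by (simp add: algebra_simps)
    moreover have "a i + b i = \<bar>y i\<bar>" "a i - b i = y i"
      by (auto simp: a_def b_def)
    ultimately show ?thesis
      by simp
  qed
  have weight: "max (sum a {1..n}) (sum b {1..n}) = ((\<Sum>i\<in>{1..n}. \<bar>y i\<bar>) + \<bar>\<Sum>i\<in>{1..n}. y i\<bar>) / 2"
    unfolding a_def b_def by (rule max_sum_pos_neg_parts)
  from mem show ?thesis
    by (simp only: vector weight)
qed

lemma hom_polytope_bounds:
  assumes p: "p \<in> hom_polytope n m"
  shows "i \<in> {1..n} \<Longrightarrow> (\<Sum>k\<in>{1..m}. \<bar>p (Inr (i, k))\<bar>) \<le> p (Inl i)"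
    and "(\<Sum>i\<in>{1..n}. p (Inl i)) + (\<Sum>k\<in>{1..m}. \<bar>\<Sum>i\<in>{1..n}. p (Inr (i, k))\<bar>) \<le> 2"
proof -
  assume i: "i \<in> {1..n}"
  define s where "s k = (if k \<in> {1..m} then (if 0 \<le> p (Inr (i, k)) then -1 else 1) else (0::real))" for k
  have "s \<in> sign_vectors m"
    by (auto simp: s_def sign_vectors_def)
  then have "0 \<le> coord_eval m p s i"
    using p i by (simp add: hom_polytope_def)
  moreover have "(\<Sum>k\<in>{1..m}. s k * p (Inr (i, k))) = - (\<Sum>k\<in>{1..m}. \<bar>p (Inr (i, k))\<bar>)"
    unfolding sum_negf[symmetric] by (rule sum.cong) (auto simp: s_def)
  ultimately show "(\<Sum>k\<in>{1..m}. \<bar>p (Inr (i, k))\<bar>) \<le> p (Inl i)"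
    by (simp add: coord_eval_def)
next
  define s where "s k = (if k \<in> {1..m} then (if 0 \<le> (\<Sum>i\<in>{1..n}. p (Inr (i, k))) then 1 else -1) else (0::real))" for k
  have "s \<in> sign_vectors m"
    by (auto simp: s_def sign_vectors_def)
  then have "(\<Sum>j\<in>{1..n}. coord_eval m p s j) \<le> 2"
    using p by (simp add: hom_polytope_def)
  moreover have "(\<Sum>j\<in>{1..n}. coord_eval m p s j)
      = (\<Sum>i\<in>{1..n}. p (Inl i)) + (\<Sum>k\<in>{1..m}. s k * (\<Sum>i\<in>{1..n}. p (Inr (i, k))))"
    by (simp add: coord_eval_def sum.distrib sum_distrib_left) (rule sum.swap)
  moreover have "(\<Sum>k\<in>{1..m}. s k * (\<Sum>i\<in>{1..n}. p (Inr (i, k)))) = (\<Sum>k\<in>{1..m}. \<bar>\<Sum>i\<in>{1..n}. p (Inr (i, k))\<bar>)"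
    by (rule sum.cong) (auto simp: s_def)
  ultimately show "(\<Sum>i\<in>{1..n}. p (Inl i)) + (\<Sum>k\<in>{1..m}. \<bar>\<Sum>i\<in>{1..n}. p (Inr (i, k))\<bar>) \<le> 2"
    by simp
qed

lemma valid_support_decomposition:
  assumes "\<And>z. \<not> valid_index n m z \<Longrightarrow> p z = 0"
  shows "p = (\<Sum>i\<in>{1..n}. (p (Inl i) - (\<Sum>k\<in>{1..m}. \<bar>p (Inr (i, k))\<bar>)) *\<^sub>R eS i)
      + (\<Sum>k\<in>{1..m}. \<Sum>i\<in>{1..n}. \<bar>p (Inr (i, k))\<bar> *\<^sub>R eS i + p (Inr (i, k)) *\<^sub>R eD i k)"
proof
  fix z
  have "(if P \<and> Q then a else 0) = (if P then if Q then a else 0 else 0)"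
    "(\<Sum>j\<in>A. if P then f j else 0) = (if P then sum f A else 0)"
    for P Q and a :: real and f :: "nat \<Rightarrow> real" and A
    by simp_all
  then show "p z = ((\<Sum>i\<in>{1..n}. (p (Inl i) - (\<Sum>k\<in>{1..m}. \<bar>p (Inr (i, k))\<bar>)) *\<^sub>R eS i)
      + (\<Sum>k\<in>{1..m}. \<Sum>i\<in>{1..n}. \<bar>p (Inr (i, k))\<bar> *\<^sub>R eS i + p (Inr (i, k)) *\<^sub>R eD i k)) z"
    using assms
    by (cases z) (auto simp: sum_fun_apply valid_index_def if_distrib[of "\<lambda>a. _ * a"] sum.delta cong: if_cong)
qed

lemma hom_polytope_subset_convex_hull: "hom_polytope n m \<subseteq> convex hull hom_pts n m"
proof
  let ?C = "convex hull hom_pts n m"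
  fix p assume p: "p \<in> hom_polytope n m"
  define x where "x i = p (Inl i)" for i
  define y where "y k i = p (Inr (i, k))" for k i
  have C: "convex ?C" "0 \<in> ?C"
    by (auto intro: hull_inc simp: hom_pts_def)
  have diag: "(\<Sum>k\<in>{1..m}. \<bar>y k i\<bar>) \<le> x i" if "i \<in> {1..n}" for i
    using hom_polytope_bounds(1)[OF p that] by (simp add: x_def y_def)
  have "p = (\<Sum>i\<in>{1..n}. (x i - (\<Sum>k\<in>{1..m}. \<bar>y k i\<bar>)) *\<^sub>R eS i)
      + (\<Sum>k\<in>{1..m}. \<Sum>i\<in>{1..n}. \<bar>y k i\<bar> *\<^sub>R eS i + y k i *\<^sub>R eD i k)"
    unfolding x_def y_def using p by (intro valid_support_decomposition) (simp add: hom_polytope_def)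
  also have "\<dots> \<in> (*\<^sub>R) ((\<Sum>i\<in>{1..n}. (x i - (\<Sum>k\<in>{1..m}. \<bar>y k i\<bar>)) / 2)
      + (\<Sum>k\<in>{1..m}. ((\<Sum>i\<in>{1..n}. \<bar>y k i\<bar>) + \<bar>\<Sum>i\<in>{1..n}. y k i\<bar>) / 2)) ` ?C"
  proof (intro scaleR_image_convex_add[OF C(1)] scaleR_image_convex_sum[OF C])
    show "(\<Sum>i\<in>{1..n}. \<bar>y k i\<bar> *\<^sub>R eS i + y k i *\<^sub>R eD i k)
        \<in> (*\<^sub>R) (((\<Sum>i\<in>{1..n}. \<bar>y k i\<bar>) + \<bar>\<Sum>i\<in>{1..n}. y k i\<bar>) / 2) ` ?C" if "k \<in> {1..m}" for k
      using that by (rule column_mem_scaled_convex_hull)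
    show "(x i - (\<Sum>k\<in>{1..m}. \<bar>y k i\<bar>)) *\<^sub>R eS i
        \<in> (*\<^sub>R) ((x i - (\<Sum>k\<in>{1..m}. \<bar>y k i\<bar>)) / 2) ` ?C" if "i \<in> {1..n}" for i
    proof -
      have "2 *\<^sub>R eS i \<in> ?C"
        using that by (intro hull_inc) (auto simp: hom_pts_def)
      then show ?thesis
        by (rule rev_image_eqI) simp
    qed
  qed (use diag in \<open>auto intro!: sum_nonneg\<close>)
  also have "\<dots> \<subseteq> (*\<^sub>R) 1 ` ?C"
  proof (rule scaleR_image_convex_mono[OF C])
    have "(\<Sum>i\<in>{1..n}. (x i - (\<Sum>k\<in>{1..m}. \<bar>y k i\<bar>)) / 2)
        + (\<Sum>k\<in>{1..m}. ((\<Sum>i\<in>{1..n}. \<bar>y k i\<bar>) + \<bar>\<Sum>i\<in>{1..n}. y k i\<bar>) / 2)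
        = ((\<Sum>i\<in>{1..n}. x i) + (\<Sum>k\<in>{1..m}. \<bar>\<Sum>i\<in>{1..n}. y k i\<bar>)) / 2" (is "?w = _")
      by (simp add: sum.distrib sum_subtractf add_divide_distrib diff_divide_distrib
          flip: sum_divide_distrib) (rule sum.swap)
    then show "?w \<le> 1"
      using hom_polytope_bounds(2)[OF p] by (simp add: x_def y_def)
  qed (use diag in \<open>auto intro!: sum_nonneg add_nonneg_nonneg\<close>)
  finally show "p \<in> ?C" by simp
qed

lemma hom_polytope_eq_convex_hull: "hom_polytope n m = convex hull hom_pts n m"
  using hom_polytope_subset_convex_hull convex_hull_hom_pts_subset by blast

section \<open>Vertices\<close>

lemma linear_separation_not_in_convex_hull:
  fixes l :: "'a::real_vector \<Rightarrow> real"
  assumes "linear l" "\<forall>q\<in>S. l q \<le> c" "c < l p"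
  shows "p \<notin> convex hull S"
proof -
  have "convex hull S \<subseteq> l -` {..c}"
    using assms(2) by (intro hull_minimal convex_linear_vimage[OF assms(1)]) (auto simp: convex_real_interval)
  then show ?thesis
    using assms(3) by auto
qed

definition coord_sum :: "nat \<Rightarrow> (nat + nat \<times> nat \<Rightarrow> real) \<Rightarrow> real" where
  "coord_sum n v = (\<Sum>i\<in>{1..n}. v (Inl i))"

lemma coord_sum_simps [simp]:
  "coord_sum n 0 = 0"
  "coord_sum n (v + w) = coord_sum n v + coord_sum n w"
  "coord_sum n (v - w) = coord_sum n v - coord_sum n w"
  "coord_sum n (c *\<^sub>R v) = c * coord_sum n v"
  "coord_sum n (eS i) = (if i \<in> {1..n} then 1 else 0)"
  "coord_sum n (eD i k) = 0"
  by (simp_all add: coord_sum_def sum.distrib sum_subtractf sum_distrib_left)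

lemma hom_pt_not_in_convex_hull_others:
  assumes "p \<in> hom_pts n m"
  shows "p \<notin> convex hull (hom_pts n m - {p})"
  using assms[unfolded hom_pts_def]
proof (elim UnE CollectE exE conjE insertE)
  assume p: "p = 0"
  show ?thesis
  proof (rule linear_separation_not_in_convex_hull[where l = "\<lambda>v. - coord_sum n v" and c = "-1"])
    show "\<forall>q\<in>hom_pts n m - {p}. - coord_sum n q \<le> -1"
      using p unfolding hom_pts_def by auto
  qed (auto intro: linearI simp: p)
next
  fix a assume p: "p = 2 *\<^sub>R eS a" "a \<in> {1..n}"
  show ?thesis
  proof (rule linear_separation_not_in_convex_hull[where l = "\<lambda>v. v (Inl a)" and c = 1])
    show "\<forall>q\<in>hom_pts n m - {p}. q (Inl a) \<le> 1"
      using p unfolding hom_pts_def by (auto split: if_splits)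
  qed (auto intro: linearI simp: p)
next
  fix a b assume p: "p = eS a + eD a b" "a \<in> {1..n}" "b \<in> {1..m}"
  show ?thesis
  proof (rule linear_separation_not_in_convex_hull[where l = "\<lambda>v. 2 * v (Inr (a, b)) - coord_sum n v" and c = 0])
    show "\<forall>q\<in>hom_pts n m - {p}. 2 * q (Inr (a, b)) - coord_sum n q \<le> 0"
      using p unfolding hom_pts_def by (auto split: if_splits)
  qed (auto intro: linearI simp: p algebra_simps)
next
  fix a b assume p: "p = eS a - eD a b" "a \<in> {1..n}" "b \<in> {1..m}"
  show ?thesis
  proof (rule linear_separation_not_in_convex_hull[where l = "\<lambda>v. - 2 * v (Inr (a, b)) - coord_sum n v" and c = 0])
    show "\<forall>q\<in>hom_pts n m - {p}. - 2 * q (Inr (a, b)) - coord_sum n q \<le> 0"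
      using p unfolding hom_pts_def by (auto split: if_splits)
  qed (auto intro: linearI simp: p algebra_simps)
next
  fix a b c assume p: "p = (eS a + eS b) + (eD a c - eD b c)" "a \<in> {1..n}" "b \<in> {1..n}" "a \<noteq> b" "c \<in> {1..m}"
  show ?thesis
  proof (rule linear_separation_not_in_convex_hull[where l = "\<lambda>v. v (Inr (a, c)) - v (Inr (b, c))" and c = 1])
    show "\<forall>q\<in>hom_pts n m - {p}. q (Inr (a, c)) - q (Inr (b, c)) \<le> 1"
      using p unfolding hom_pts_def by (auto split: if_splits)
  qed (use p(4) in \<open>auto intro: linearI simp: p(1) algebra_simps\<close>)
qed simp

definition offdiag_triples :: "nat \<Rightarrow> nat \<Rightarrow> (nat \<times> nat \<times> nat) set" where
  "offdiag_triples n m = (SIGMA i:{1..n}. ({1..n} - {i}) \<times> {1..m})"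

lemma hom_pts_eq_Un:
  "hom_pts n m = {0} \<union> (\<lambda>i. 2 *\<^sub>R eS i) ` {1..n}
     \<union> (\<lambda>(i, k). eS i + eD i k) ` ({1..n} \<times> {1..m})
     \<union> (\<lambda>(i, k). eS i - eD i k) ` ({1..n} \<times> {1..m})
     \<union> (\<lambda>(i, j, k). (eS i + eS j) + (eD i k - eD j k)) ` offdiag_triples n m"
proof -
  have "{2 *\<^sub>R eS i | i. i \<in> {1..n}} = (\<lambda>i. 2 *\<^sub>R eS i) ` {1..n}"
    by auto
  moreover have "{eS i + eD i k | i k. i \<in> {1..n} \<and> k \<in> {1..m}} = (\<lambda>(i, k). eS i + eD i k) ` ({1..n} \<times> {1..m})"
    "{eS i - eD i k | i k. i \<in> {1..n} \<and> k \<in> {1..m}} = (\<lambda>(i, k). eS i - eD i k) ` ({1..n} \<times> {1..m})"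
    by (auto; blast)+
  moreover have "{(eS i + eS j) + (eD i k - eD j k) | i j k. i \<in> {1..n} \<and> j \<in> {1..n} \<and> i \<noteq> j \<and> k \<in> {1..m}}
      = (\<lambda>(i, j, k). (eS i + eS j) + (eD i k - eD j k)) ` offdiag_triples n m"
  proof (intro equalityI subsetI)
    fix v assume "v \<in> (\<lambda>(i, j, k). (eS i + eS j) + (eD i k - eD j k)) ` offdiag_triples n m"
    then obtain i j k where "v = (eS i + eS j) + (eD i k - eD j k)" "(i, j, k) \<in> offdiag_triples n m"
      by auto
    then show "v \<in> {(eS i + eS j) + (eD i k - eD j k) | i j k. i \<in> {1..n} \<and> j \<in> {1..n} \<and> i \<noteq> j \<and> k \<in> {1..m}}"
      unfolding offdiag_triples_def by blast
  next
    fix v assume "v \<in> {(eS i + eS j) + (eD i k - eD j k) | i j k. i \<in> {1..n} \<and> j \<in> {1..n} \<and> i \<noteq> j \<and> k \<in> {1..m}}"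
    then obtain i j k where "v = (eS i + eS j) + (eD i k - eD j k)"
      and "i \<in> {1..n}" "j \<in> {1..n}" "i \<noteq> j" "k \<in> {1..m}"
      by blast
    moreover from this have "(i, j, k) \<in> offdiag_triples n m"
      by (simp add: offdiag_triples_def)
    ultimately show "v \<in> (\<lambda>(i, j, k). (eS i + eS j) + (eD i k - eD j k)) ` offdiag_triples n m"
      by force
  qed
  ultimately show ?thesis
    unfolding hom_pts_def by simp
qed

lemma finite_hom_pts: "finite (hom_pts n m)"
  by (simp add: hom_pts_eq_Un offdiag_triples_def)

lemma extreme_points_convex_hull_hom_pts:
  "{v. v extreme_point_of (convex hull hom_pts n m)} = hom_pts n m"
proof
  show "{v. v extreme_point_of (convex hull hom_pts n m)} \<subseteq> hom_pts n m"
    by (rule extreme_points_of_convex_hull)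
  show "hom_pts n m \<subseteq> {v. v extreme_point_of (convex hull hom_pts n m)}"
  proof
    fix p assume p: "p \<in> hom_pts n m"
    then have "insert p (hom_pts n m - {p}) = hom_pts n m"
      by auto
    moreover have "p extreme_point_of convex hull (insert p (hom_pts n m - {p}))"
      using finite_hom_pts hom_pt_not_in_convex_hull_others[OF p]
      by (intro extreme_point_of_convex_hull_insert) auto
    ultimately show "p \<in> {v. v extreme_point_of (convex hull hom_pts n m)}"
      by simp
  qed
qed

lemma card_offdiag_triples: "card (offdiag_triples n m) = n * ((n - 1) * m)"
proof -
  have "card (offdiag_triples n m) = (\<Sum>i\<in>{1..n}. card (({1..n} - {i}) \<times> {1..m}))"
    unfolding offdiag_triples_def by (rule card_SigmaI) auto
  also have "\<dots> = (\<Sum>i\<in>{1..n}. (n - 1) * m)"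
    by (rule sum.cong) (auto simp: card_cartesian_product)
  finally show ?thesis by simp
qed

lemma inj_on_hom_pts_params:
  "inj_on (\<lambda>i. 2 *\<^sub>R eS i) A"
  "inj_on (\<lambda>(i, k). eS i + eD i k) B"
  "inj_on (\<lambda>(i, k). eS i - eD i k) B"
  "inj_on (\<lambda>(i, j, k). (eS i + eS j) + (eD i k - eD j k)) (offdiag_triples n m)"
proof -
  show "inj_on (\<lambda>i. 2 *\<^sub>R eS i) A"
    by (rule inj_onI) (drule fun_cong[where x = "Inl _"], auto split: if_splits)
  show "inj_on (\<lambda>(i, k). eS i + eD i k) B"
  proof (rule inj_onI, clarify)
    fix i k i' k' assume "eS i + eD i k = eS i' + eD i' k'"
    from fun_cong[OF this, of "Inr (i, k)"] show "i = i' \<and> k = k'"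
      by (simp split: if_splits)
  qed
  show "inj_on (\<lambda>(i, k). eS i - eD i k) B"
  proof (rule inj_onI, clarify)
    fix i k i' k' assume "eS i - eD i k = eS i' - eD i' k'"
    from fun_cong[OF this, of "Inr (i, k)"] show "i = i' \<and> k = k'"
      by (simp split: if_splits)
  qed
  show "inj_on (\<lambda>(i, j, k). (eS i + eS j) + (eD i k - eD j k)) (offdiag_triples n m)"
  proof (rule inj_onI)
    fix x y assume x: "x \<in> offdiag_triples n m" and y: "y \<in> offdiag_triples n m"
    obtain i j k i' j' k' where xy: "x = (i, j, k)" "y = (i', j', k')"
      by (cases x, cases y) auto
    have "i \<noteq> j" "i' \<noteq> j'"
      using x y by (auto simp: xy offdiag_triples_def)
    assume "(\<lambda>(i, j, k). (eS i + eS j) + (eD i k - eD j k)) x = (\<lambda>(i, j, k). (eS i + eS j) + (eD i k - eD j k)) y"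
    then have eq: "(eS i + eS j) + (eD i k - eD j k) = (eS i' + eS j') + (eD i' k' - eD j' k')"
      by (simp add: xy)
    have "i = i' \<and> k = k'"
      using fun_cong[OF eq, of "Inr (i, k)"] \<open>i \<noteq> j\<close> \<open>i' \<noteq> j'\<close> by (auto split: if_splits)
    moreover have "j = j'"
      using fun_cong[OF eq, of "Inr (j, k)"] \<open>i \<noteq> j\<close> \<open>i' \<noteq> j'\<close> calculation by (auto split: if_splits)
    ultimately show "x = y"
      by (simp add: xy)
  qed
qed

lemma card_hom_pts: "card (hom_pts n m) = (n + 1) * (m * n + 1)"
proof -
  let ?D = "(\<lambda>i. 2 *\<^sub>R eS i) ` {1..n}"
  let ?P = "(\<lambda>(i, k). eS i + eD i k) ` ({1..n} \<times> {1..m})"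
  let ?M = "(\<lambda>(i, k). eS i - eD i k) ` ({1..n} \<times> {1..m})"
  let ?T = "(\<lambda>(i, j, k). (eS i + eS j) + (eD i k - eD j k)) ` offdiag_triples n m"
  text \<open>The families are told apart by the sum of the \<open>e\<^sub>i\<close>-coordinates (0, 2, 1, 1, 2), except
    \<open>e\<^sub>i + e\<^sub>i\<^sub>k\<close> versus \<open>e\<^sub>j - e\<^sub>j\<^sub>l\<close> and \<open>2e\<^sub>a\<close> versus the pairs, which differ at a coordinate \<open>e\<^sub>i\<^sub>k\<close>.\<close>
  have plus_ne_minus: "eS i + eD i k \<noteq> eS j - eD j l" for i j k l
  proof
    assume "eS i + eD i k = eS j - eD j l"
    from fun_cong[OF this, of "Inr (i, k)"] show False
      by (simp split: if_splits)
  qed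
  have double_ne_pair: "2 *\<^sub>R eS a \<noteq> (eS i + eS j) + (eD i k - eD j k)" if "i \<noteq> j" for a i j k
  proof
    assume "2 *\<^sub>R eS a = (eS i + eS j) + (eD i k - eD j k)"
    from fun_cong[OF this, of "Inr (i, k)"] show False
      using that by simp
  qed
  have "{0} \<inter> ?D = {}" "({0} \<union> ?D) \<inter> ?P = {}" "({0} \<union> ?D) \<inter> ?M = {}"
      "({0} \<union> ?P \<union> ?M) \<inter> ?T = {}"
    by (auto simp: offdiag_triples_def dest!: arg_cong[where f = "coord_sum n"])
  moreover have "?P \<inter> ?M = {}"
    using plus_ne_minus by auto
  moreover have "?D \<inter> ?T = {}"
    using double_ne_pair by (fastforce simp: offdiag_triples_def)
  ultimately have "{0} \<inter> ?D = {}" "({0} \<union> ?D) \<inter> ?P = {}" "({0} \<union> ?D \<union> ?P) \<inter> ?M = {}"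
      "({0} \<union> ?D \<union> ?P \<union> ?M) \<inter> ?T = {}"
    by (simp_all only: Int_Un_distrib2 Un_empty)
  moreover have "finite ?D" "finite ?P" "finite ?M" "finite ?T"
    by (simp_all add: offdiag_triples_def)
  moreover have "card ?D = n" "card ?P = n * m" "card ?M = n * m" "card ?T = n * ((n - 1) * m)"
    by (simp_all add: card_image inj_on_hom_pts_params card_cartesian_product card_offdiag_triples)
  ultimately have "card (hom_pts n m) = 1 + n + n * m + n * m + n * ((n - 1) * m)"
    unfolding hom_pts_eq_Un by (simp add: card_Un_disjoint)
  also have "\<dots> = (n + 1) * (m * n + 1)"
    by (cases n) (simp_all add: algebra_simps)
  finally show ?thesis .
qed

theorem corollary4p2:
  fixes m n :: nat
  shows "card {f. f extreme_point_of Hom (cube_std m) (simplex_std n)} = (n + 1) * (m * n + 1)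
       \<and> affinely_isomorphic (Hom (cube_std m) (simplex_std n)) (convex hull hom_pts n m)
       \<and> {v. v extreme_point_of (convex hull hom_pts n m)} = hom_pts n m"
proof (intro conjI)
  let ?H = "Hom (cube_std m) (simplex_std n)"
  have bij: "bij_betw (hom_of_coords n m) (convex hull hom_pts n m) ?H"
    using bij_betw_hom_of_coords by (simp add: hom_polytope_eq_convex_hull)
  then have "{f. f extreme_point_of ?H} = hom_of_coords n m ` hom_pts n m"
    unfolding bij_betw_def
    using extreme_points_of_inj_linear_image[OF linear_hom_of_coords _ convex_convex_hull]
      extreme_points_convex_hull_hom_pts by metis
  moreover have "inj_on (hom_of_coords n m) (hom_pts n m)"
    using bij hull_subset[of "hom_pts n m" convex] by (auto simp: bij_betw_def intro: inj_on_subset)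
  ultimately show "card {f. f extreme_point_of ?H} = (n + 1) * (m * n + 1)"
    by (simp add: card_image card_hom_pts)
  show "affinely_isomorphic ?H (convex hull hom_pts n m)"
    unfolding affinely_isomorphic_def
    using bij_betw_hom_coords[of n m] linear_imp_affine_map_on[OF linear_hom_coords]
    by (auto simp: hom_polytope_eq_convex_hull)
  show "{v. v extreme_point_of (convex hull hom_pts n m)} = hom_pts n m"
    by (rule extreme_points_convex_hull_hom_pts)
qed

end
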